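(* Let $q\in[0,1]$ and let $T_q:\mathbf H_2\to\mathcal F_{2,q}$ be the linear operator determined by $T_q z^n=\frac{z^n}{[n]_q!}$, $n=0,1,2,\ldots$. Then on $\mathbf H_2$ it holds that $$R_qT_q=T_qR_0 .$$
   Context: For $q\in[0,1]$ put $[n]_q=1+q+\cdots+q^{n-1}$ for $n\ge1$, $[0]_q!=1$ and $[n]_q!=[1]_q[2]_q\cdots[n]_q$. $\mathbf H_2$ is the Hardy space of the open unit disk (power series $\sum a_nz^n$ with $\sum|a_n|^2<\infty$). $\mathcal F_{2,q}$ is the Hilbert space of power series $f(z)=\sum_{n\ge 0} f_nz^n$ with $\sum_{n\ge 0}|f_n|^2([n]_q!)^2<\infty$ and inner product $\langle f,g\rangle=\sum_{n\ge 0} f_n\overline{g_n}([n]_q!)^2$; its reproducing kernel is $\sum_{n\ge 0}\frac{z^n\overline w^n}{([n]_q!)^2}$. The operator $T_q$ acts by $T_q\left(\sum a_nz^n\right)=\sum \frac{a_n}{[n]_q!}z^n$. For $0\le q<1$, $R_qf(z)=\frac{f(z)-f(qz)}{(1-q)z}$ (extended analytically to $z=0$), and $R_1=\partial$ is differentiation; in particular $R_0f(z)=\frac{f(z)-f(0)}{z}$ is the backward shift. *)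

theory Defs
  imports "HOL-Analysis.Analysis"
begin

definition q_bracket :: "real \<Rightarrow> nat \<Rightarrow> real" where
  "q_bracket q n = (\<Sum>k<n. q ^ k)"

definition q_fact :: "real \<Rightarrow> nat \<Rightarrow> real" where
  "q_fact q n = (\<Prod>k=1..n. q_bracket q k)"

text \<open>
  Elements of the function spaces are functions \<open>complex \<Rightarrow> complex\<close> of which only the values on the
  domain of the space matter; equality in a space is therefore equality on that domain.
\<close>

definition hardy2 :: "(complex \<Rightarrow> complex) set" where
  "hardy2 = {f. \<exists>a :: nat \<Rightarrow> complex. summable (\<lambda>n. (norm (a n))\<^sup>2) \<and>
                  (\<forall>z\<in>ball 0 1. (\<lambda>n. a n * z ^ n) sums f z)}"

text \<open>
  The open disc of radius \<open>1 / (1 - q)\<close>, which is the whole plane for \<open>q = 1\<close>. It is the largest open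
  disc about the origin on which every power series of the space \<open>fock2 q\<close> below converges,
  since \<open>q_bracket q n\<close> tends to \<open>1 / (1 - q)\<close>.
\<close>

definition q_disc :: "real \<Rightarrow> complex set" where
  "q_disc q = {z. (1 - q) * norm z < 1}"

definition fock2 :: "real \<Rightarrow> (complex \<Rightarrow> complex) set" where
  "fock2 q = {f. \<exists>a :: nat \<Rightarrow> complex. summable (\<lambda>n. (norm (a n))\<^sup>2 * (q_fact q n)\<^sup>2) \<and>
                   (\<forall>z\<in>q_disc q. (\<lambda>n. a n * z ^ n) sums f z)}"

definition taylor_coeff :: "(complex \<Rightarrow> complex) \<Rightarrow> nat \<Rightarrow> complex" where
  "taylor_coeff f n = (deriv ^^ n) f 0 / fact n"

definition T_op :: "real \<Rightarrow> (complex \<Rightarrow> complex) \<Rightarrow> complex \<Rightarrow> complex" where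
  "T_op q f z = (\<Sum>n. taylor_coeff f n / of_real (q_fact q n) * z ^ n)"

text \<open>For \<open>q < 1\<close> the value at the origin is the continuous (hence analytic) extension of the quotient.\<close>

definition R_op :: "real \<Rightarrow> (complex \<Rightarrow> complex) \<Rightarrow> complex \<Rightarrow> complex" where
  "R_op q f z =
     (if q = 1 then deriv f z
      else if z = 0 then Lim (at 0) (\<lambda>w. (f w - f (of_real q * w)) / ((1 - of_real q) * w))
      else (f z - f (of_real q * z)) / ((1 - of_real q) * z))"

lemma taylor_coeff_eqI:
  assumes "e > 0" "\<And>z. norm z < e \<Longrightarrow> (\<lambda>n. b n * z ^ n) sums g z"
  shows "taylor_coeff g n = b n"
proof -
  have "eventually (\<lambda>z. (\<lambda>n. fps_nth (Abs_fps b) n * z ^ n) sums g z) (nhds 0)"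
    unfolding eventually_nhds_metric using assms by (auto simp: dist_norm)
  then have "g has_fps_expansion Abs_fps b"
    by (rule has_fps_expansionI)
  from fps_nth_fps_expansion[OF this, of n] show ?thesis
    by (simp add: taylor_coeff_def)
qed

lemma T_monomial: "T_op q (\<lambda>z. z ^ n) = (\<lambda>z. z ^ n / of_real (q_fact q n))"
proof -
  have c: "taylor_coeff (\<lambda>z. z ^ n) k = (if k = n then 1 else 0)" for k
  proof (rule taylor_coeff_eqI[of 1])
    fix z :: complex
    show "(\<lambda>k. (if k = n then 1 else 0) * z ^ k) sums z ^ n"
      using sums_single[of n "\<lambda>k. z ^ k"] by (simp add: if_distrib if_distribR cong: if_cong)
  qed simp
  have "(\<lambda>k. taylor_coeff (\<lambda>z. z ^ n) k / of_real (q_fact q k) * z ^ k) sums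
          (z ^ n / of_real (q_fact q n))" for z :: complex
    using sums_single[of n "\<lambda>k. z ^ k / of_real (q_fact q k)"]
    by (simp add: c if_distrib if_distribR cong: if_cong)
  then show ?thesis by (auto simp: T_op_def sums_iff)
qed

end

theory Submission
  imports Defs
begin

text \<open>
  On power series, \<open>R_q\<close> sends the coefficients \<open>a\<^sub>n\<close> to \<open>[n+1]_q a\<^sub>n\<^sub>+\<^sub>1\<close>, which for \<open>q = 0\<close> is the
  plain shift. Since \<open>[n+1]_q / [n+1]_q! = 1 / [n]_q!\<close>, both sides of the identity have the
  coefficients \<open>a\<^sub>n\<^sub>+\<^sub>1 / [n]_q!\<close>.
\<close>

lemma q_bracket_Suc_ge_1:
  assumes "0 \<le> q"
  shows "1 \<le> q_bracket q (Suc n)"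
  using assms by (simp add: q_bracket_def sum.lessThan_Suc_shift sum_nonneg del: sum.lessThan_Suc)

text \<open>Only the term \<open>0 ^ 0 = 1\<close> survives; this is what turns
  \<open>R_op 0\<close> into the unweighted shift.\<close>

lemma q_bracket_0_Suc: "q_bracket 0 (Suc n) = 1"
  by (simp add: q_bracket_def sum.lessThan_Suc_shift del: sum.lessThan_Suc)

text \<open>The geometric sum, kept in product form so that it also covers
  \<open>q = 1\<close>.\<close>

lemma one_minus_mult_q_bracket: "(1 - q) * q_bracket q n = 1 - q ^ n"
  by (simp add: q_bracket_def one_diff_power_eq)

lemma q_fact_Suc: "q_fact q (Suc n) = q_fact q n * q_bracket q (Suc n)"
  by (simp add: q_fact_def)

lemma q_fact_pos:
  assumes "0 \<le> q"
  shows "0 < q_fact q n"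
proof (induction n)
  case 0
  show ?case by (simp add: q_fact_def)
next
  case (Suc n)
  then show ?case using q_bracket_Suc_ge_1[OF assms, of n] by (simp add: q_fact_Suc)
qed

text \<open>The brackets tend to \<open>1 / (1 - q)\<close>, or to infinity for
  \<open>q = 1\<close>. Stating the bound on \<open>r\<close> as a product treats both cases: for
  \<open>q = 1\<close> it allows every \<open>r\<close>.\<close>

lemma eventually_q_bracket_gt:
  assumes "0 \<le> q" "q \<le> 1" "(1 - q) * r < 1"
  shows "eventually (\<lambda>n. r < q_bracket q n) sequentially"
proof (cases "q = 1")
  case True
  have "filterlim real at_top sequentially"
    by (rule filterlim_real_sequentially)
  then show ?thesis
    using True by (simp add: q_bracket_def filterlim_at_top_dense)
next
  case False
  have "(\<lambda>n. 1 - q ^ n) \<longlonglongrightarrow> 1 - 0"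
    using assms False by (intro tendsto_diff tendsto_const LIMSEQ_realpow_zero) auto
  then have "eventually (\<lambda>n. (1 - q) * r < 1 - q ^ n) sequentially"
    using assms(3) by (auto dest: order_tendstoD(1))
  then show ?thesis
    by eventually_elim (use assms False in \<open>simp flip: one_minus_mult_q_bracket\<close>)
qed

text \<open>The disc is open, so a radius slightly larger than \<open>norm z\<close> still satisfies
  its inequality; letting \<open>r\<close> decrease to \<open>norm z\<close> avoids dividing by
  \<open>1 - q\<close>.\<close>

lemma q_disc_radius:
  assumes "q \<le> 1" "z \<in> q_disc q"
  obtains r where "norm z < r" "(1 - q) * r < 1"
proof -
  have "((\<lambda>r. (1 - q) * r) \<longlongrightarrow> (1 - q) * norm z) (at_right (norm z))"
    by (intro tendsto_intros)
  then have "eventually (\<lambda>r. (1 - q) * r < 1 \<and> norm z < r) (at_right (norm z))"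
    using assms by (intro eventually_conj order_tendstoD(2) eventually_at_right_less)
      (auto simp: q_disc_def)
  then obtain r where "(1 - q) * r < 1" "norm z < r"
    using eventually_happens'[OF trivial_limit_at_right_real] by blast
  then show thesis using that by blast
qed

lemma q_disc_norm_less:
  assumes "q \<le> 1" "(1 - q) * r < 1" "norm z < r"
  shows "z \<in> q_disc q"
  using mult_left_mono[of "norm z" r "1 - q"] assms by (simp add: q_disc_def)

text \<open>This is the series of the q-exponential function at \<open>norm z\<close>. The ratio of
  consecutive terms is \<open>norm z / q_bracket q (Suc n)\<close>, eventually below
  \<open>norm z / r < 1\<close> for an \<open>r\<close> between \<open>norm z\<close> and the limit
  of the brackets.\<close>

lemma summable_q_exponential:
  assumes q: "0 \<le> q" "q \<le> 1" and z: "z \<in> q_disc q"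
  shows "summable (\<lambda>n. norm z ^ n / q_fact q n)"
proof -
  obtain r where r: "norm z < r" "(1 - q) * r < 1"
    using q_disc_radius[OF q(2) z] .
  then have "0 < r" using norm_ge_zero[of z] by linarith
  obtain N where N: "\<And>n. n \<ge> N \<Longrightarrow> r < q_bracket q n"
    using eventually_q_bracket_gt[OF q r(2)] by (auto simp: eventually_sequentially)
  show ?thesis
  proof (rule summable_ratio_test[of "norm z / r" N])
    show "norm z / r < 1" using r \<open>0 < r\<close> by simp
  next
    fix n assume "N \<le> n"
    then have "r < q_bracket q (Suc n)" using N[of "Suc n"] by simp
    then have "norm z / q_bracket q (Suc n) * (norm z ^ n / q_fact q n)
        \<le> norm z / r * (norm z ^ n / q_fact q n)"
      using \<open>0 < r\<close> q_fact_pos[OF q(1), of n]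
      by (intro mult_right_mono divide_left_mono) auto
    then show "norm (norm z ^ Suc n / q_fact q (Suc n)) \<le> norm z / r * norm (norm z ^ n / q_fact q n)"
      using q_fact_pos[OF q(1), of n] \<open>0 < r\<close> \<open>r < q_bracket q (Suc n)\<close>
      by (simp add: q_fact_Suc abs_mult mult.commute)
  qed
qed

text \<open>Square-summable coefficients tend to 0, hence are eventually bounded by 1, and the
  q-exponential series dominates.\<close>

lemma summable_q_exponential_mult:
  fixes a :: "nat \<Rightarrow> complex"
  assumes "0 \<le> q" "q \<le> 1" "z \<in> q_disc q" and a: "summable (\<lambda>n. (norm (a n))\<^sup>2)"
  shows "summable (\<lambda>n. a n / of_real (q_fact q n) * z ^ n)"
proof -
  have "eventually (\<lambda>n. (norm (a n))\<^sup>2 < 1) sequentially"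
    using summable_LIMSEQ_zero[OF a] by (rule order_tendstoD) simp
  then have "eventually (\<lambda>n. norm (a n / of_real (q_fact q n) * z ^ n) \<le> norm z ^ n / q_fact q n)
      sequentially"
  proof eventually_elim
    case (elim n)
    then have "norm (a n) \<le> 1" by (simp add: abs_square_less_1)
    then have "norm (a n) * (norm z ^ n / q_fact q n) \<le> 1 * (norm z ^ n / q_fact q n)"
      using q_fact_pos[OF assms(1), of n] by (intro mult_right_mono) auto
    then show ?case
      using q_fact_pos[OF assms(1), of n]
      by (simp add: norm_mult norm_divide norm_power)
  qed
  then show ?thesis
    by (rule summable_comparison_test_ev[OF _ summable_q_exponential[OF assms(1-3)]])
qed

text \<open>By uniqueness of power series, \<open>a\<close> is the sequence of Taylor coefficients
  of \<open>f\<close>. An expansion of \<open>f\<close> on the unit disc suffices for convergence of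
  the image on all of \<open>q_disc q\<close>.\<close>

lemma T_op_sums:
  assumes "0 \<le> q" "q \<le> 1" "z \<in> q_disc q" "summable (\<lambda>n. (norm (a n))\<^sup>2)"
    and "\<And>z. z \<in> ball 0 1 \<Longrightarrow> (\<lambda>n. a n * z ^ n) sums f z"
  shows "(\<lambda>n. a n / of_real (q_fact q n) * z ^ n) sums T_op q f z"
proof -
  have "taylor_coeff f n = a n" for n
    by (rule taylor_coeff_eqI[of 1]) (use assms(5) in auto)
  then show ?thesis
    using summable_q_exponential_mult[OF assms(1-4)] by (simp add: T_op_def summable_sums)
qed

text \<open>Termwise, \<open>z ^ n - (q * z) ^ n = (1 - q ^ n) * z ^ n\<close>, and dividing by
  \<open>(1 - q) * z\<close> leaves the bracket times \<open>z ^ (n - 1)\<close>. The radius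
  \<open>r\<close> is free because the result is needed both inside \<open>q_disc q\<close> and,
  with \<open>q = 0\<close>, on the unit disc.\<close>

lemma R_op_sums:
  fixes a :: "nat \<Rightarrow> complex"
  assumes q: "0 \<le> q" "q \<le> 1"
    and f: "\<And>z. norm z < r \<Longrightarrow> (\<lambda>n. a n * z ^ n) sums f z"
    and z: "norm z < r"
  shows "(\<lambda>n. of_real (q_bracket q (Suc n)) * a (Suc n) * z ^ n) sums R_op q f z"
proof (cases "q = 1")
  case True
  have "(\<lambda>n. diffs a n * z ^ n) sums (\<Sum>n. diffs a n * z ^ n)"
    using termdiff_converges[OF z] f by (auto simp: summable_sums sums_iff)
  moreover have "((\<lambda>z. \<Sum>n. a n * z ^ n) has_field_derivative (\<Sum>n. diffs a n * z ^ n)) (at z)"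
    using f by (intro termdiffs_strong'[OF _ z]) (auto simp: sums_iff)
  \<comment> \<open>\<open>f\<close> is known to agree with its series only on
    \<open>ball 0 r\<close>; since this ball is open, the derivative carries over.\<close>
  then have "(f has_field_derivative (\<Sum>n. diffs a n * z ^ n)) (at z)"
    by (rule has_field_derivative_transform_within_open[of _ _ _ "ball 0 r"])
      (use z f in \<open>auto simp: sums_iff\<close>)
  ultimately show ?thesis
    using True by (simp add: R_op_def DERIV_imp_deriv diffs_def q_bracket_def)
next
  case False
  let ?quot = "\<lambda>w. (f w - f (of_real q * w)) / ((1 - of_real q) * w)"
  have *: "(\<lambda>n. of_real (q_bracket q (Suc n)) * a (Suc n) * w ^ n) sums ?quot w"
    if w: "w \<noteq> 0" "norm w < r" for w
  proof -
    have "norm (of_real q * w) < r"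
      using le_less_trans[OF mult_left_le_one_le[of "norm w" q] w(2)] q by (simp add: norm_mult)
    from sums_diff[OF f[OF w(2)] f[OF this]]
    have "(\<lambda>n. a n * w ^ n - a n * (of_real q * w) ^ n) sums (f w - f (of_real q * w))" .
    \<comment> \<open>The constant terms of the two series cancel, so the index can start at
      1.\<close>
    then have "(\<lambda>n. a (Suc n) * w ^ Suc n - a (Suc n) * (of_real q * w) ^ Suc n)
        sums (f w - f (of_real q * w))"
      by (subst sums_Suc_iff) simp
    then have "(\<lambda>n. (a (Suc n) * w ^ Suc n - a (Suc n) * (of_real q * w) ^ Suc n)
        / ((1 - of_real q) * w)) sums ?quot w"
      by (rule sums_divide)
    moreover have "(a (Suc n) * w ^ Suc n - a (Suc n) * (of_real q * w) ^ Suc n)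
        / ((1 - of_real q) * w) = of_real (q_bracket q (Suc n)) * a (Suc n) * w ^ n" for n
    proof -
      have eq: "(1 - of_real q) * of_real (q_bracket q (Suc n)) = (1 - of_real q ^ Suc n :: complex)"
        using arg_cong[OF one_minus_mult_q_bracket[of q "Suc n"], of complex_of_real] by simp
      have "a (Suc n) * w ^ Suc n - a (Suc n) * (of_real q * w) ^ Suc n
          = a (Suc n) * w ^ Suc n * ((1 - of_real q) * of_real (q_bracket q (Suc n)))"
        unfolding eq by (simp add: algebra_simps)
      moreover have "1 - of_real q \<noteq> (0 :: complex)"
        using False by (metis eq_iff_diff_eq_0 of_real_eq_1_iff)
      ultimately show ?thesis using w by simp
    qed
    ultimately show ?thesis by simp
  qed
  show ?thesis
  proof (cases "z = 0")
    case True
    then have "0 < r" using z by simp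
    \<comment> \<open>Off the origin the quotient equals a convergent power series, so its limit at
      0 is the constant term.\<close>
    have "(?quot \<longlongrightarrow> of_real (q_bracket q (Suc 0)) * a (Suc 0)) (at 0)"
      by (rule powser_limit_0_strong[OF \<open>0 < r\<close>, where a = "\<lambda>n. of_real (q_bracket q (Suc n)) * a (Suc n)"])
         (rule *)
    then have "R_op q f z = of_real (q_bracket q (Suc 0)) * a (Suc 0)"
      using False True by (simp add: R_op_def tendsto_Lim)
    then show ?thesis
      using powser_sums_zero[of "\<lambda>n. of_real (q_bracket q (Suc n)) * a (Suc n)"] True by simp
  next
    case z0: False
    then show ?thesis using *[OF z0 z] False by (simp add: R_op_def)
  qed
qed

theorem lemma4p3:
  fixes q :: real
  assumes "q \<in> {0..1}"
  shows "T_op q \<in> hardy2 \<rightarrow> fock2 q \<and>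
         (\<forall>f\<in>hardy2. \<forall>z\<in>q_disc q. R_op q (T_op q f) z = T_op q (R_op 0 f) z)"
proof (intro conjI ballI funcsetI)
  have q: "0 \<le> q" "q \<le> 1" using assms by auto
  have nz: "q_fact q n \<noteq> 0" for n using q_fact_pos[OF q(1), of n] by simp
  fix f assume "f \<in> hardy2"
  then obtain a where a: "summable (\<lambda>n. (norm (a n))\<^sup>2)"
    and f: "\<And>z. z \<in> ball 0 1 \<Longrightarrow> (\<lambda>n. a n * z ^ n) sums f z"
    by (auto simp: hardy2_def)
  note T = T_op_sums[OF q _ a f]
  \<comment> \<open>The weight of the target space cancels the denominators: the operator preserves
    the norm.\<close>
  have "(\<lambda>n. (norm (a n / of_real (q_fact q n)))\<^sup>2 * (q_fact q n)\<^sup>2) = (\<lambda>n. (norm (a n))\<^sup>2)"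
    by (simp add: norm_divide power_divide nz)
  then show "T_op q f \<in> fock2 q"
    unfolding fock2_def using a T
    by (intro CollectI exI[of _ "\<lambda>n. a n / of_real (q_fact q n)"]) auto
  fix z assume z: "z \<in> q_disc q"
  obtain r where r: "norm z < r" "(1 - q) * r < 1"
    using q_disc_radius[OF q(2) z] .
  \<comment> \<open>The disc of radius \<open>r\<close> lies inside \<open>q_disc q\<close>, so the
    expansion of \<open>T_op q f\<close> holds on all of it.\<close>
  have "(\<lambda>n. of_real (q_bracket q (Suc n)) * (a (Suc n) / of_real (q_fact q (Suc n))) * z ^ n)
      sums R_op q (T_op q f) z"
    by (rule R_op_sums[OF q T r(1)]) (rule q_disc_norm_less[OF q(2) r(2)])
  moreover have "of_real (q_bracket q (Suc n)) * (a (Suc n) / of_real (q_fact q (Suc n)))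
      = a (Suc n) / of_real (q_fact q n)" for n
    using q_bracket_Suc_ge_1[OF q(1), of n] by (simp add: q_fact_Suc)
  moreover have "(\<lambda>n. a (Suc n) / of_real (q_fact q n) * z ^ n) sums T_op q (R_op 0 f) z"
  \<comment> \<open>\<open>R_op 0 f\<close> is again in the Hardy space, with the shifted
    coefficients.\<close>
  proof (rule T_op_sums[OF q z])
    show "summable (\<lambda>n. (norm (a (Suc n)))\<^sup>2)"
      using a by (subst summable_Suc_iff)
    show "(\<lambda>n. a (Suc n) * w ^ n) sums R_op 0 f w" if "w \<in> ball 0 1" for w
      using R_op_sums[of 0 1 a f w] f that by (simp add: q_bracket_0_Suc)
  qed
  ultimately show "R_op q (T_op q f) z = T_op q (R_op 0 f) z"
    by (simp only: sums_unique2)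
qed

end
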